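(* Let $T$ be a topological group acting continuously on a locally connected compact Hausdorff space $X$, i.e. let $(X,T)$ be a flow. Then the factor map $\pi_{S_{eq}}\colon X\to X/S_{eq}$ from $(X,T)$ to its maximal equicontinuous factor $(X/S_{eq},T)$ is monotone, i.e. the preimage of every point of $X/S_{eq}$ under $\pi_{S_{eq}}$ is a connected subset of $X$.
   Context: A flow $(X,T)$ consists of a topological space $X$, a topological group $T$ and a continuous map $f\colon X\times T\to X$ with $f(x,e)=x$ and $f(f(x,s),t)=f(x,st)$ for all $x\in X$, $s,t\in T$; write $f^t:=f(\cdot,t)$. An equivalence relation $S$ on $X$ is closed if it is closed in $X\times X$, and $T$-invariant if $(x,y)\in S$ implies $(f^t(x),f^t(y))\in S$ for all $t\in T$. For such an $S$ on a compact Hausdorff space, $X/S$ with the quotient topology is compact Hausdorff, and $T$ acts on it by the induced action, giving the flow $(X/S,T)$; $\pi_S\colon X\to X/S$ denotes the quotient map. A flow on a compact Hausdorff space is equicontinuous if the family $\{f^t : t\in T\}$ is equicontinuous with respect to the unique compatible uniformity. For a flow $(X,T)$ on a compact Hausdorff space there is a smallest closed $T$-invariant equivalence relation $S_{eq}$ such that $(X/S_{eq},T)$ is equicontinuous; $(X/S_{eq},T)$ is called the maximal equicontinuous factor (MEF) of $(X,T)$. *)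

theory Defs
  imports "HOL-Analysis.Analysis" "HOL-Algebra.Group"
begin

section \<open>Flows\<close>

text \<open>No separation axiom is imposed on the topology of the group.\<close>

locale topological_group = group G for G :: "('g, 'm) monoid_scheme" (structure) +
  fixes \<tau> :: "'g topology"
  assumes topspace_group: "topspace \<tau> = carrier G"
    and continuous_map_group_mult: "continuous_map (prod_topology \<tau> \<tau>) \<tau> (\<lambda>(s, t). s \<otimes> t)"
    and continuous_map_group_inv: "continuous_map \<tau> \<tau> (\<lambda>t. inv t)"

locale flow = topological_group G \<tau> for G :: "('g, 'm) monoid_scheme" (structure) and \<tau> +
  fixes X :: "'a topology" and f :: "'a \<Rightarrow> 'g \<Rightarrow> 'a"
  assumes continuous_map_action: "continuous_map (prod_topology X \<tau>) X (\<lambda>(x, t). f x t)"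
    and action_one: "x \<in> topspace X \<Longrightarrow> f x \<one> = x"
    and action_mult: "x \<in> topspace X \<Longrightarrow> s \<in> carrier G \<Longrightarrow> t \<in> carrier G \<Longrightarrow>
          f (f x s) t = f x (s \<otimes> t)"
begin

lemma action_closed: "x \<in> topspace X \<Longrightarrow> t \<in> carrier G \<Longrightarrow> f x t \<in> topspace X"
  using continuous_map_action topspace_group by (auto simp: continuous_map_def Pi_iff)

end


section \<open>The uniformity of a compact Hausdorff space\<close>

definition uniform_structure_on :: "'a set \<Rightarrow> ('a \<times> 'a) set set \<Rightarrow> bool" where
  "uniform_structure_on A \<U> \<longleftrightarrow>
     \<U> \<noteq> {} \<and>
     (\<forall>E\<in>\<U>. E \<subseteq> A \<times> A \<and> Id_on A \<subseteq> E) \<and>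
     (\<forall>E\<in>\<U>. \<forall>F. E \<subseteq> F \<and> F \<subseteq> A \<times> A \<longrightarrow> F \<in> \<U>) \<and>
     (\<forall>E\<in>\<U>. \<forall>F\<in>\<U>. E \<inter> F \<in> \<U>) \<and>
     (\<forall>E\<in>\<U>. E\<inverse> \<in> \<U>) \<and>
     (\<forall>E\<in>\<U>. \<exists>D\<in>\<U>. D O D \<subseteq> E)"

lemma
  assumes "uniform_structure_on A \<U>" "E \<in> \<U>"
  shows uniform_structure_on_subset: "E \<subseteq> A \<times> A"
    and uniform_structure_on_refl: "x \<in> A \<Longrightarrow> (x, x) \<in> E"
    and uniform_structure_on_mono: "E \<subseteq> F \<Longrightarrow> F \<subseteq> A \<times> A \<Longrightarrow> F \<in> \<U>"
    and uniform_structure_on_Int: "F \<in> \<U> \<Longrightarrow> E \<inter> F \<in> \<U>"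
    and uniform_structure_on_converse: "E\<inverse> \<in> \<U>"
    and uniform_structure_on_half: "\<exists>D\<in>\<U>. D O D \<subseteq> E"
proof -
  note u = assms(1)[unfolded uniform_structure_on_def, THEN conjunct2]
  note sub = bspec[OF u[THEN conjunct1] assms(2)]
    and u1 = u[THEN conjunct2]
  show "E \<subseteq> A \<times> A" "x \<in> A \<Longrightarrow> (x, x) \<in> E"
    using sub by auto
  show "F \<in> \<U>" if "E \<subseteq> F" "F \<subseteq> A \<times> A"
    using bspec[OF u1[THEN conjunct1] assms(2)] that by (elim allE) (erule mp, intro conjI)
  note u2 = u1[THEN conjunct2]
  show "E \<inter> F \<in> \<U>" if "F \<in> \<U>"
    using bspec[OF bspec[OF u2[THEN conjunct1] assms(2)] that] .
  note u3 = u2[THEN conjunct2]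
  show "E\<inverse> \<in> \<U>"
    using bspec[OF u3[THEN conjunct1] assms(2)] .
  show "\<exists>D\<in>\<U>. D O D \<subseteq> E"
    using bspec[OF u3[THEN conjunct2] assms(2)] .
qed

definition compatible_uniformity :: "'a topology \<Rightarrow> ('a \<times> 'a) set set \<Rightarrow> bool" where
  "compatible_uniformity X \<U> \<longleftrightarrow>
     uniform_structure_on (topspace X) \<U> \<and>
     (\<forall>U. openin X U \<longleftrightarrow> U \<subseteq> topspace X \<and> (\<forall>x\<in>U. \<exists>E\<in>\<U>. E `` {x} \<subseteq> U))"

text \<open>This is meaningful only if there is exactly one compatible uniformity, which
  \<open>compatible_uniformity_ex1\<close> below shows for compact Hausdorff spaces.\<close>

definition uniformity_of :: "'a topology \<Rightarrow> ('a \<times> 'a) set set" where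
  "uniformity_of X = (THE \<U>. compatible_uniformity X \<U>)"

definition diagonal_nhds :: "'a topology \<Rightarrow> ('a \<times> 'a) set set" where
  "diagonal_nhds X = {E. E \<subseteq> topspace X \<times> topspace X \<and>
     (\<exists>W. openin (prod_topology X X) W \<and> Id_on (topspace X) \<subseteq> W \<and> W \<subseteq> E)}"

lemma diagonal_nhdsI:
  assumes "openin (prod_topology X X) W" "Id_on (topspace X) \<subseteq> W" "W \<subseteq> E"
    "E \<subseteq> topspace X \<times> topspace X"
  shows "E \<in> diagonal_nhds X"
  unfolding diagonal_nhds_def using assms by (intro CollectI conjI exI[of _ W])

lemma diagonal_nhdsE:
  assumes "E \<in> diagonal_nhds X"
  obtains W where "openin (prod_topology X X) W" "Id_on (topspace X) \<subseteq> W" "W \<subseteq> E"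
    "E \<subseteq> topspace X \<times> topspace X"
  using assms unfolding diagonal_nhds_def by blast

lemma openin_prod_diagonal_box:
  assumes "openin (prod_topology X X) W" "(x, x) \<in> W"
  obtains N where "openin X N" "x \<in> N" "N \<times> N \<subseteq> W"
proof -
  obtain U V where UV: "openin X U" "openin X V" "x \<in> U" "x \<in> V" "U \<times> V \<subseteq> W"
    using assms by (metis openin_prod_topology_alt)
  show thesis
    by (rule that[of "U \<inter> V"]) (use UV in auto)
qed

lemma uniform_interior:
  assumes "compatible_uniformity X \<U>" "D \<in> \<U>" "x \<in> topspace X"
  obtains V where "openin X V" "x \<in> V" "V \<subseteq> D `` {x}"
proof -
  let ?A = "topspace X"
  have us: "uniform_structure_on ?A \<U>"
    and op: "\<And>U. openin X U \<longleftrightarrow> U \<subseteq> ?A \<and> (\<forall>x\<in>U. \<exists>E\<in>\<U>. E `` {x} \<subseteq> U)"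
    using assms by (auto simp: compatible_uniformity_def)
  have refl: "(y, y) \<in> E" if "E \<in> \<U>" "y \<in> ?A" for E y
    using uniform_structure_on_refl[OF us] that by blast
  have sub: "E \<subseteq> ?A \<times> ?A" if "E \<in> \<U>" for E
    using uniform_structure_on_subset[OF us] that by blast
  define V where "V = {y \<in> ?A. \<exists>F\<in>\<U>. F `` {y} \<subseteq> D `` {x}}"
  have "\<exists>E\<in>\<U>. E `` {y} \<subseteq> V" if "y \<in> V" for y
  proof -
    obtain F where F: "F \<in> \<U>" "F `` {y} \<subseteq> D `` {x}"
      using \<open>y \<in> V\<close> unfolding V_def by auto
    obtain F' where F': "F' \<in> \<U>" "F' O F' \<subseteq> F"
      using uniform_structure_on_half[OF us F(1)] by blast
    have "F' `` {y} \<subseteq> V"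
      using F F' sub[OF F'(1)] unfolding V_def by blast
    then show ?thesis using F' by blast
  qed
  then have "openin X V"
    unfolding op by (auto simp: V_def)
  moreover have "x \<in> V" using assms V_def by auto
  moreover have "V \<subseteq> D `` {x}" using refl V_def by blast
  ultimately show thesis using that by blast
qed

lemma compatible_uniformity_unique:
  assumes X: "compact_space X" and comp: "compatible_uniformity X \<U>"
  shows "\<U> = diagonal_nhds X"
proof
  let ?A = "topspace X"
  have us: "uniform_structure_on ?A \<U>"
    and op: "\<And>U. openin X U \<longleftrightarrow> U \<subseteq> ?A \<and> (\<forall>x\<in>U. \<exists>E\<in>\<U>. E `` {x} \<subseteq> U)"
    using comp by (auto simp: compatible_uniformity_def)
  have refl: "(y, y) \<in> E" if "E \<in> \<U>" "y \<in> ?A" for E y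
    using uniform_structure_on_refl[OF us] that by blast
  have sub: "E \<subseteq> ?A \<times> ?A" if "E \<in> \<U>" for E
    using uniform_structure_on_subset[OF us] that by blast
  have up: "F \<in> \<U>" if "E \<in> \<U>" "E \<subseteq> F" "F \<subseteq> ?A \<times> ?A" for E F
    using uniform_structure_on_mono[OF us] that by blast
  have int: "E \<inter> F \<in> \<U>" if "E \<in> \<U>" "F \<in> \<U>" for E F
    using uniform_structure_on_Int[OF us] that by blast
  have conv: "E\<inverse> \<in> \<U>" if "E \<in> \<U>" for E
    using uniform_structure_on_converse[OF us] that by blast
  have half: "\<exists>D\<in>\<U>. D O D \<subseteq> E" if "E \<in> \<U>" for E
    using uniform_structure_on_half[OF us] that by blast
  have "\<U> \<noteq> {}"
    using us by (simp add: uniform_structure_on_def)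
  then have whole: "?A \<times> ?A \<in> \<U>"
    using up sub by blast
  show "\<U> \<subseteq> diagonal_nhds X"
  proof
    fix E assume E: "E \<in> \<U>"
    obtain H where H: "H \<in> \<U>" "H O H \<subseteq> E" using half[OF E] by blast
    define D where "D = H \<inter> H\<inverse>"
    have D: "D \<in> \<U>" using H int conv D_def by auto
    have "\<exists>V. openin X V \<and> x \<in> V \<and> V \<subseteq> D `` {x}" if "x \<in> ?A" for x
      using uniform_interior[OF comp D that] by metis
    then obtain V where V: "\<And>x. x \<in> ?A \<Longrightarrow> openin X (V x) \<and> x \<in> V x \<and> V x \<subseteq> D `` {x}"
      by metis
    define W where "W = (\<Union>x\<in>?A. V x \<times> V x)"
    have "openin (prod_topology X X) W"
      unfolding W_def using V by (auto simp: openin_prod_Times_iff)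
    moreover have "Id_on ?A \<subseteq> W" using V W_def by auto
    moreover have "W \<subseteq> E"
      using V H unfolding W_def D_def by blast
    ultimately show "E \<in> diagonal_nhds X"
      using sub[OF E] unfolding diagonal_nhds_def by blast
  qed
  show "diagonal_nhds X \<subseteq> \<U>"
  proof
    fix E assume "E \<in> diagonal_nhds X"
    then obtain W where EA: "E \<subseteq> ?A \<times> ?A" and W: "openin (prod_topology X X) W"
      "Id_on ?A \<subseteq> W" "W \<subseteq> E"
      unfolding diagonal_nhds_def by blast
    have "\<exists>N F V. N \<times> N \<subseteq> W \<and> F \<in> \<U> \<and> (F O F) `` {x} \<subseteq> N \<and>
             openin X V \<and> x \<in> V \<and> V \<subseteq> F `` {x}" if x: "x \<in> ?A" for x
    proof -
      have "(x, x) \<in> W" using W x by auto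
      then obtain N where N: "openin X N" "x \<in> N" "N \<times> N \<subseteq> W"
        using openin_prod_diagonal_box W by metis
      obtain H where H: "H \<in> \<U>" "H `` {x} \<subseteq> N" using N op by blast
      obtain F where F: "F \<in> \<U>" "F O F \<subseteq> H" using half[OF H(1)] by blast
      obtain V where "openin X V" "x \<in> V" "V \<subseteq> F `` {x}"
        using uniform_interior[OF comp F(1) x] by metis
      moreover have "(F O F) `` {x} \<subseteq> N" using F H by blast
      ultimately show ?thesis using N F by blast
    qed
    then obtain N F V where NFV: "\<And>x. x \<in> ?A \<Longrightarrow> N x \<times> N x \<subseteq> W \<and> F x \<in> \<U> \<and>
        (F x O F x) `` {x} \<subseteq> N x \<and> openin X (V x) \<and> x \<in> V x \<and> V x \<subseteq> F x `` {x}"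
      by metis
    have "compactin X ?A" using X compact_space_def by blast
    moreover have "\<forall>U\<in>V ` ?A. openin X U" "?A \<subseteq> \<Union>(V ` ?A)" using NFV by auto
    ultimately obtain K where K: "finite K" "K \<subseteq> V ` ?A" "?A \<subseteq> \<Union>K"
      unfolding compactin_def by meson
    then obtain P where P: "finite P" "P \<subseteq> ?A" "K = V ` P"
      by (metis finite_subset_image)
    define D where "D = ?A \<times> ?A \<inter> (\<Inter>p\<in>P. F p)"
    have "?A \<times> ?A \<inter> (\<Inter>p\<in>Q. F p) \<in> \<U>" if "finite Q" "Q \<subseteq> P" for Q
      using that
    proof (induction Q rule: finite_induct)
      case empty
      then show ?case using whole by simp
    next
      case (insert q Q)
      then have "F q \<inter> (?A \<times> ?A \<inter> (\<Inter>p\<in>Q. F p)) \<in> \<U>"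
        using P NFV int by blast
      then show ?case by (simp add: Int_left_commute)
    qed
    then have "D \<in> \<U>" using P D_def by blast
    moreover have "D \<subseteq> W"
    proof clarify
      fix a b assume ab: "(a, b) \<in> D"
      then have aA: "a \<in> ?A" using D_def by blast
      then obtain p where p: "p \<in> P" "a \<in> V p" using K P by blast
      then have pA: "p \<in> ?A" using P by blast
      have "(p, a) \<in> F p" using NFV pA p by blast
      moreover have "(a, a) \<in> F p" "(a, b) \<in> F p"
        using NFV pA p ab D_def refl aA by auto
      ultimately have "a \<in> N p" "b \<in> N p" using NFV[OF pA] by blast+
      then show "(a, b) \<in> W" using NFV[OF pA] by blast
    qed
    ultimately show "E \<in> \<U>" using up W EA by blast
  qed
qed

lemma diagonal_nhds_half:
  assumes X: "compact_space X" "Hausdorff_space X"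
    and W: "openin (prod_topology X X) W" "Id_on (topspace X) \<subseteq> W"
  shows "\<exists>D. openin (prod_topology X X) D \<and> Id_on (topspace X) \<subseteq> D \<and> D O D \<subseteq> W"
proof -
  let ?A = "topspace X"
  have reg: "regular_space X"
    using X by (simp add: compact_Hausdorff_imp_regular_space)
  have "\<exists>N M C. openin X N \<and> openin X M \<and> closedin X C \<and> x \<in> M \<and> M \<subseteq> C \<and> C \<subseteq> N \<and> N \<times> N \<subseteq> W"
    if x: "x \<in> ?A" for x
  proof -
    have "(x, x) \<in> W" using W x by auto
    then obtain N where N: "openin X N" "x \<in> N" "N \<times> N \<subseteq> W"
      using openin_prod_diagonal_box W by metis
    moreover obtain M C where "openin X M" "closedin X C" "x \<in> M" "M \<subseteq> C" "C \<subseteq> N"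
      using reg N unfolding neighbourhood_base_of_closedin[symmetric] neighbourhood_base_of
      by meson
    ultimately show ?thesis by blast
  qed
  then obtain N M C where NMC: "\<And>x. x \<in> ?A \<Longrightarrow> openin X (N x) \<and> openin X (M x) \<and>
      closedin X (C x) \<and> x \<in> M x \<and> M x \<subseteq> C x \<and> C x \<subseteq> N x \<and> N x \<times> N x \<subseteq> W"
    by metis
  have "compactin X ?A" using X compact_space_def by blast
  moreover have "\<forall>U\<in>M ` ?A. openin X U" "?A \<subseteq> \<Union>(M ` ?A)" using NMC by auto
  ultimately obtain K where K: "finite K" "K \<subseteq> M ` ?A" "?A \<subseteq> \<Union>K"
    unfolding compactin_def by meson
  then obtain P where P: "finite P" "P \<subseteq> ?A" "K = M ` P"
    by (metis finite_subset_image)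
  define B where "B p = N p \<times> N p \<union> (?A - C p) \<times> (?A - C p)" for p
  define D where "D = ?A \<times> ?A \<inter> (\<Inter>p\<in>P. B p)"
  have opB: "openin (prod_topology X X) (B p)" if "p \<in> P" for p
  proof -
    have n: "openin X (N p)" "closedin X (C p)" using NMC P that by blast+
    then have "openin X (?A - C p)" by (simp add: openin_diff)
    then show ?thesis
      unfolding B_def using n by (intro openin_Un) (simp_all add: openin_prod_Times_iff)
  qed
  have whole: "openin (prod_topology X X) (?A \<times> ?A)"
    by (simp add: openin_prod_Times_iff)
  have "openin (prod_topology X X) (?A \<times> ?A \<inter> (\<Inter>p\<in>Q. B p))" if "finite Q" "Q \<subseteq> P" for Q
    using that
  proof (induction Q rule: finite_induct)
    case empty
    then show ?case using whole by simp
  next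
    case (insert q Q)
    then have "openin (prod_topology X X) (B q \<inter> (?A \<times> ?A \<inter> (\<Inter>p\<in>Q. B p)))"
      using opB by (intro openin_Int[of _ "B q"]) auto
    then show ?case by (simp add: Int_left_commute)
  qed
  then have "openin (prod_topology X X) D" using P D_def by blast
  moreover have "Id_on ?A \<subseteq> D"
    using NMC P unfolding D_def B_def by blast
  moreover have "D O D \<subseteq> W"
  proof clarify
    fix a b c assume ab: "(a, b) \<in> D" and bc: "(b, c) \<in> D"
    then have "b \<in> ?A" using D_def by blast
    then obtain p where p: "p \<in> P" "b \<in> M p" using K P by blast
    have "p \<in> ?A" using p P by blast
    note n = NMC[OF this]
    have "a \<in> N p" "c \<in> N p"
      using ab bc p n unfolding D_def B_def by blast+
    then show "(a, c) \<in> W" using n by blast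
  qed
  ultimately show ?thesis by blast
qed

lemma compatible_uniformity_diagonal_nhds:
  assumes X: "compact_space X" "Hausdorff_space X"
  shows "compatible_uniformity X (diagonal_nhds X)"
proof -
  let ?A = "topspace X" and ?P = "prod_topology X X"
  have whole: "openin ?P (?A \<times> ?A)"
    by (simp add: openin_prod_Times_iff)
  have ne: "diagonal_nhds X \<noteq> {}"
    using whole unfolding diagonal_nhds_def by blast
  have int: "E \<inter> F \<in> diagonal_nhds X" if EF: "E \<in> diagonal_nhds X" "F \<in> diagonal_nhds X" for E F
  proof -
    obtain V W where "openin ?P V" "Id_on ?A \<subseteq> V" "V \<subseteq> E" "openin ?P W" "Id_on ?A \<subseteq> W" "W \<subseteq> F"
      using EF by (metis diagonal_nhdsE)
    then have "openin ?P (V \<inter> W)" "Id_on ?A \<subseteq> V \<inter> W" "V \<inter> W \<subseteq> E \<inter> F" by auto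
    moreover have "E \<inter> F \<subseteq> ?A \<times> ?A" using EF(1) by (elim diagonal_nhdsE) blast
    ultimately show ?thesis by (rule diagonal_nhdsI)
  qed
  have conv: "E\<inverse> \<in> diagonal_nhds X" if E: "E \<in> diagonal_nhds X" for E
  proof -
    obtain W where W: "openin ?P W" "Id_on ?A \<subseteq> W" "W \<subseteq> E" "E \<subseteq> ?A \<times> ?A"
      using E by (metis diagonal_nhdsE)
    have "openin ?P (W\<inverse>)"
      unfolding openin_prod_topology_alt
    proof (intro allI impI)
      fix x y assume "(x, y) \<in> W\<inverse>"
      then have "(y, x) \<in> W" by simp
      then obtain U V where "openin X U" "openin X V" "y \<in> U" "x \<in> V" "U \<times> V \<subseteq> W"
        using W(1) by (metis openin_prod_topology_alt)
      moreover from this have "V \<times> U \<subseteq> W\<inverse>" by auto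
      ultimately show "\<exists>U V. openin X U \<and> openin X V \<and> x \<in> U \<and> y \<in> V \<and> U \<times> V \<subseteq> W\<inverse>"
        by metis
    qed
    moreover have "Id_on ?A \<subseteq> W\<inverse>" "W\<inverse> \<subseteq> E\<inverse>" "E\<inverse> \<subseteq> ?A \<times> ?A" using W by auto
    ultimately show ?thesis by (rule diagonal_nhdsI)
  qed
  have half: "\<exists>D\<in>diagonal_nhds X. D O D \<subseteq> E" if E: "E \<in> diagonal_nhds X" for E
  proof -
    obtain W where W: "openin ?P W" "Id_on ?A \<subseteq> W" "W \<subseteq> E"
      using E by (metis diagonal_nhdsE)
    obtain D where D: "openin ?P D" "Id_on ?A \<subseteq> D" "D O D \<subseteq> W"
      using diagonal_nhds_half[OF X W(1,2)] by blast
    have "D \<subseteq> ?A \<times> ?A" using openin_subset[OF D(1)] by simp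
    then have "D \<in> diagonal_nhds X" using D by (intro diagonal_nhdsI[of X D]) auto
    moreover have "D O D \<subseteq> E" using D(3) W(3) by (rule subset_trans)
    ultimately show ?thesis by (rule bexI[rotated])
  qed
  have sub: "E \<subseteq> ?A \<times> ?A \<and> Id_on ?A \<subseteq> E" if "E \<in> diagonal_nhds X" for E
    using that by (elim diagonal_nhdsE) auto
  have mono: "F \<in> diagonal_nhds X"
    if E: "E \<in> diagonal_nhds X" and F: "E \<subseteq> F \<and> F \<subseteq> ?A \<times> ?A" for E F
  proof -
    obtain W where "openin ?P W" "Id_on ?A \<subseteq> W" "W \<subseteq> E"
      using E by (metis diagonal_nhdsE)
    then show ?thesis using F by (intro diagonal_nhdsI[of X W]) auto
  qed
  have us: "uniform_structure_on ?A (diagonal_nhds X)"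
    unfolding uniform_structure_on_def
  proof (intro conjI ballI allI impI)
    show "diagonal_nhds X \<noteq> {}" by (rule ne)
  next
    fix E assume E: "E \<in> diagonal_nhds X"
    show "E \<subseteq> ?A \<times> ?A" "Id_on ?A \<subseteq> E" using sub[OF E] by simp_all
    show "F \<in> diagonal_nhds X" if "E \<subseteq> F \<and> F \<subseteq> ?A \<times> ?A" for F by (rule mono[OF E that])
    show "E \<inter> F \<in> diagonal_nhds X" if "F \<in> diagonal_nhds X" for F by (rule int[OF E that])
    show "E\<inverse> \<in> diagonal_nhds X" by (rule conv[OF E])
    show "\<exists>D\<in>diagonal_nhds X. D O D \<subseteq> E" by (rule half[OF E])
  qed
  have nhd: "\<exists>E\<in>diagonal_nhds X. E `` {x} \<subseteq> U" if U: "openin X U" "x \<in> U" for U x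
  proof -
    define W where "W = U \<times> U \<union> (?A - {x}) \<times> (?A - {x})"
    have UA: "U \<subseteq> ?A" using openin_subset U by blast
    have "closedin X {x}"
      using X UA U by (meson closedin_Hausdorff_singleton subsetD)
    then have "openin X (?A - {x})" by (simp add: openin_diff)
    then have "openin ?P W"
      unfolding W_def using U by (intro openin_Un) (simp_all add: openin_prod_Times_iff)
    moreover have "Id_on ?A \<subseteq> W" "W \<subseteq> ?A \<times> ?A"
      using U UA unfolding W_def by auto
    ultimately have "W \<in> diagonal_nhds X" by (intro diagonal_nhdsI[of X W]) auto
    moreover have "W `` {x} \<subseteq> U" unfolding W_def by auto
    ultimately show ?thesis by (rule bexI[rotated])
  qed
  have op: "openin X U" if U: "U \<subseteq> ?A" "\<forall>x\<in>U. \<exists>E\<in>diagonal_nhds X. E `` {x} \<subseteq> U" for U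
  proof (subst openin_subopen, clarify)
    fix x assume x: "x \<in> U"
    then obtain E where E: "E \<in> diagonal_nhds X" "E `` {x} \<subseteq> U" using U by blast
    then obtain W where W: "openin ?P W" "Id_on ?A \<subseteq> W" "W \<subseteq> E"
      by (metis diagonal_nhdsE)
    have "(x, x) \<in> W" using W x U by auto
    then obtain N where N: "openin X N" "x \<in> N" "N \<times> N \<subseteq> W"
      using openin_prod_diagonal_box W by metis
    then have "N \<subseteq> U" using W E by blast
    then show "\<exists>T. openin X T \<and> x \<in> T \<and> T \<subseteq> U" using N by blast
  qed
  have "openin X U \<longleftrightarrow> U \<subseteq> ?A \<and> (\<forall>x\<in>U. \<exists>E\<in>diagonal_nhds X. E `` {x} \<subseteq> U)" for U
    using nhd[of U] op[of U] openin_subset[of X U] by metis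
  then show ?thesis
    unfolding compatible_uniformity_def by (intro conjI us allI)
qed

theorem compatible_uniformity_ex1:
  assumes "compact_space X" "Hausdorff_space X"
  shows "\<exists>!\<U>. compatible_uniformity X \<U>"
  using compatible_uniformity_diagonal_nhds[OF assms] compatible_uniformity_unique[OF assms(1)]
  by (rule ex1I)

corollary uniformity_of_eq_diagonal_nhds:
  assumes "compact_space X" "Hausdorff_space X"
  shows "uniformity_of X = diagonal_nhds X"
  unfolding uniformity_of_def
  by (intro the_equality compatible_uniformity_diagonal_nhds[OF assms]
      compatible_uniformity_unique[OF assms(1)])


section \<open>Equicontinuous flows\<close>

text \<open>This is equicontinuity at every point; on a compact space it coincides with uniform
  equicontinuity.\<close>

definition equicontinuous_flow ::
    "('g, 'm) monoid_scheme \<Rightarrow> 'a topology \<Rightarrow> ('a \<Rightarrow> 'g \<Rightarrow> 'a) \<Rightarrow> bool" where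
  "equicontinuous_flow G X f \<longleftrightarrow>
     (\<forall>x\<in>topspace X. \<forall>E\<in>uniformity_of X. \<exists>U. openin X U \<and> x \<in> U \<and>
        (\<forall>y\<in>U. \<forall>t\<in>carrier G. (f x t, f y t) \<in> E))"


section \<open>Quotient flows\<close>

definition quotient_proj :: "('a \<times> 'a) set \<Rightarrow> 'a \<Rightarrow> 'a set" where
  "quotient_proj S x = S `` {x}"

definition quotient_topology :: "'a topology \<Rightarrow> ('a \<times> 'a) set \<Rightarrow> 'a set topology" where
  "quotient_topology X S = topology (\<lambda>\<V>. \<V> \<subseteq> topspace X // S \<and>
     openin X {x \<in> topspace X. quotient_proj S x \<in> \<V>})"

lemma openin_quotient_topology:
  "openin (quotient_topology X S) \<V> \<longleftrightarrow>
     \<V> \<subseteq> topspace X // S \<and> openin X {x \<in> topspace X. quotient_proj S x \<in> \<V>}"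
proof -
  let ?Q = "\<lambda>\<V>. {x \<in> topspace X. quotient_proj S x \<in> \<V>}"
  have "?Q (\<V> \<inter> \<W>) = ?Q \<V> \<inter> ?Q \<W>" "?Q (\<Union>\<K>) = (\<Union>\<V>\<in>\<K>. ?Q \<V>)" for \<V> \<W> \<K>
    by auto
  then have "istopology (\<lambda>\<V>. \<V> \<subseteq> topspace X // S \<and> openin X (?Q \<V>))"
    unfolding istopology_def by (auto intro!: openin_Int openin_Union)
  then show ?thesis
    by (simp add: quotient_topology_def)
qed

lemma topspace_quotient_topology: "topspace (quotient_topology X S) = topspace X // S"
proof -
  have "{x \<in> topspace X. quotient_proj S x \<in> topspace X // S} = topspace X"
    by (auto simp: quotient_proj_def intro: quotientI)
  then have "openin (quotient_topology X S) (topspace X // S)"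
    by (simp add: openin_quotient_topology)
  then show ?thesis
    by (metis openin_quotient_topology openin_subset openin_topspace subset_antisym)
qed

lemma quotient_map_quotient_proj:
  "quotient_map X (quotient_topology X S) (quotient_proj S)"
  by (auto simp: quotient_map_def topspace_quotient_topology openin_quotient_topology
      quotient_proj_def quotient_def)

text \<open>The image of a class under a time map is contained in a single class, provided that the
  relation is invariant.\<close>

definition quotient_action ::
    "('a \<times> 'a) set \<Rightarrow> ('a \<Rightarrow> 'g \<Rightarrow> 'a) \<Rightarrow> 'a set \<Rightarrow> 'g \<Rightarrow> 'a set" where
  "quotient_action S f C t = (\<Union>x\<in>C. quotient_proj S (f x t))"

definition closed_invariant_equiv ::
    "('g, 'm) monoid_scheme \<Rightarrow> 'a topology \<Rightarrow> ('a \<Rightarrow> 'g \<Rightarrow> 'a) \<Rightarrow> ('a \<times> 'a) set \<Rightarrow> bool" where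
  "closed_invariant_equiv G X f S \<longleftrightarrow>
     equiv (topspace X) S \<and> closedin (prod_topology X X) S \<and>
     (\<forall>(x, y)\<in>S. \<forall>t\<in>carrier G. (f x t, f y t) \<in> S)"

lemma quotient_action_quotient_proj:
  assumes "closed_invariant_equiv G X f S" "x \<in> topspace X" "t \<in> carrier G"
  shows "quotient_action S f (quotient_proj S x) t = quotient_proj S (f x t)"
proof -
  have eq: "equiv (topspace X) S"
    using assms by (simp add: closed_invariant_equiv_def)
  have "quotient_proj S (f y t) = quotient_proj S (f x t)" if "y \<in> quotient_proj S x" for y
  proof -
    have "(f x t, f y t) \<in> S"
      using assms that by (auto simp: closed_invariant_equiv_def quotient_proj_def)
    then show ?thesis
      using equiv_class_eq[OF eq] by (metis quotient_proj_def)
  qed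
  moreover have "x \<in> quotient_proj S x"
    using equiv_class_self[OF eq assms(2)] by (simp add: quotient_proj_def)
  ultimately show ?thesis
    unfolding quotient_action_def by blast
qed


section \<open>The maximal equicontinuous factor\<close>

definition S_eq ::
    "('g, 'm) monoid_scheme \<Rightarrow> 'a topology \<Rightarrow> ('a \<Rightarrow> 'g \<Rightarrow> 'a) \<Rightarrow> ('a \<times> 'a) set" where
  "S_eq G X f = (LEAST S. closed_invariant_equiv G X f S \<and>
     equicontinuous_flow G (quotient_topology X S) (quotient_action S f))"

end

theory Submission
  imports Defs
begin

text \<open>
  Write \<open>S\<close> for the relation \<open>S_eq\<close> and let \<open>R \<subseteq> S\<close> be the relation whose classes are the connected
  components of the classes of \<open>S\<close> (\<open>component_relation\<close>). If \<open>R\<close> is again a closed invariant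
  equivalence relation with equicontinuous quotient, then \<open>S \<subseteq> R\<close> by minimality of \<open>S\<close>, so every class
  of \<open>S\<close> is a single component of itself, that is, connected.

  Invariance of \<open>R\<close> holds because time maps are continuous and carry connected sets to connected sets.
  Closedness and equicontinuity both come from \<open>component_relation_separation\<close>: if \<open>p\<close> and \<open>q\<close> are not
  \<open>R\<close>-related, then no connected set that is almost contained in one \<open>S\<close>-class can join a point near
  \<open>p\<close> to a point near \<open>q\<close>. This is where compactness enters, because components and quasi-components of
  a compact Hausdorff space agree, so distinct components of a class are separated by disjoint open sets
  of \<open>X\<close>. For equicontinuity, start with a connected neighbourhood \<open>U\<close> of a point that is so small that,
  modulo \<open>S\<close>, all its translates are small; such a \<open>U\<close> exists as \<open>X\<close> is locally connected and \<open>X/S\<close>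
  is equicontinuous. The translates of \<open>U\<close> are connected and nearly contained in single \<open>S\<close>-classes,
  hence by the separation property they are small modulo \<open>R\<close> too.

  All this takes place in \<open>X\<close> rather than in the quotients, thanks to \<open>equicontinuous_quotient_iff\<close>: the
  open neighbourhoods of a closed equivalence relation in \<open>X \<times> X\<close> play the role of the entourages of the
  quotient. The same description shows that an intersection of equicontinuity relations is one
  (\<open>equicontinuous_modulo_Inter\<close>), so that the least element denoted by \<open>S_eq\<close> exists.
\<close>

section \<open>Compactness and separation\<close>

lemma compactin_finite_pointwise_subcover:
  assumes "compactin Z K" "\<And>p. p \<in> K \<Longrightarrow> openin Z (N p) \<and> p \<in> N p"
  obtains F where "finite F" "F \<subseteq> K" "K \<subseteq> (\<Union>p\<in>F. N p)"
proof -
  have "K \<subseteq> \<Union>(N ` K)" "\<And>U. U \<in> N ` K \<Longrightarrow> openin Z U" using assms(2) by auto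
  then obtain \<F> where "finite \<F>" "\<F> \<subseteq> N ` K" "K \<subseteq> \<Union>\<F>"
    using compactinD[OF assms(1)] by metis
  then show thesis
    using that by (metis finite_subset_image)
qed

lemma compact_Hausdorff_square:
  assumes "compact_space X" "Hausdorff_space X"
  shows "compact_space (prod_topology X X)" "Hausdorff_space (prod_topology X X)"
  using assms by (simp_all add: compact_space_prod_topology Hausdorff_space_prod_topology)

lemma separate_point_from_closedin:
  assumes "compact_space Z" "Hausdorff_space Z" "closedin Z S" "p \<in> topspace Z" "p \<notin> S"
  obtains N V where "openin Z N" "p \<in> N" "openin Z V" "S \<subseteq> V" "N \<inter> V = {}"
  using compact_Hausdorff_imp_regular_space[OF assms(1,2)] assms(3-5)
  unfolding regular_space_def disjnt_def by (metis Diff_iff)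


section \<open>Quotients of compact Hausdorff spaces\<close>

context
  fixes X :: "'a topology" and S :: "('a \<times> 'a) set"
  assumes compact: "compact_space X" and Hausdorff: "Hausdorff_space X"
    and equiv: "equiv (topspace X) S" and closed: "closedin (prod_topology X X) S"
begin

lemma quotient_proj_eq_iff:
  "x \<in> topspace X \<Longrightarrow> y \<in> topspace X \<Longrightarrow> quotient_proj S x = quotient_proj S y \<longleftrightarrow> (x, y) \<in> S"
  using equiv by (simp add: quotient_proj_def eq_equiv_class_iff)

text \<open>The saturation of a closed set \<open>C\<close> is the projection of the compact set \<open>S \<inter> C \<times> X\<close>, hence closed.\<close>

lemma closed_map_quotient_proj: "closed_map X (quotient_topology X S) (quotient_proj S)"
  unfolding closed_map_def
proof (intro allI impI)
  fix C assume C: "closedin X C"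
  have CX: "C \<subseteq> topspace X" using C closedin_subset by blast
  have SX: "S \<subseteq> topspace X \<times> topspace X"
    using closedin_subset[OF closed] by simp
  have "closedin (prod_topology X X) (S \<inter> C \<times> topspace X)"
    using C closed by (simp add: closedin_Int closedin_prod_Times_iff)
  then have "closedin X (snd ` (S \<inter> C \<times> topspace X))"
    using Abstract_Topological_Spaces.closed_map_snd[OF compact, of X] by (simp add: closed_map_def)
  moreover have "snd ` (S \<inter> C \<times> topspace X) =
      {x \<in> topspace X. quotient_proj S x \<in> quotient_proj S ` C}" (is "?L = ?R")
  proof (intro equalityI subsetI)
    fix y assume "y \<in> ?L"
    then obtain c where c: "c \<in> C" "(c, y) \<in> S" "y \<in> topspace X" by auto
    then show "y \<in> ?R" using CX quotient_proj_eq_iff[of c y] by auto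
  next
    fix y assume "y \<in> ?R"
    then obtain c where "c \<in> C" "y \<in> topspace X" "quotient_proj S c = quotient_proj S y" by auto
    then show "y \<in> ?L" using CX quotient_proj_eq_iff[of c y] by force
  qed
  ultimately have "closedin X {x \<in> topspace X. quotient_proj S x \<in> quotient_proj S ` C}" by simp
  moreover have "quotient_proj S ` C \<subseteq> topspace (quotient_topology X S)"
    using CX quotient_map_quotient_proj[of X S] by (auto simp: quotient_map_def)
  ultimately show "closedin (quotient_topology X S) (quotient_proj S ` C)"
    using quotient_map_quotient_proj[of X S] unfolding quotient_map_closedin by blast
qed

text \<open>A closed continuous image of a compact Hausdorff space is normal with closed points.\<close>

lemma compact_Hausdorff_quotient:
  "compact_space (quotient_topology X S)" "Hausdorff_space (quotient_topology X S)"
proof -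
  note q = quotient_map_quotient_proj[of X S]
  have c: "continuous_map X (quotient_topology X S) (quotient_proj S)"
    and im: "quotient_proj S ` topspace X = topspace (quotient_topology X S)"
    using q by (simp_all add: quotient_imp_continuous_map quotient_imp_surjective_map)
  show "compact_space (quotient_topology X S)"
    using compact c im by (metis compact_space_def image_compactin)
  show "Hausdorff_space (quotient_topology X S)"
    using normal_Hausdorff_space_closed_continuous_map_image
      [OF compact_Hausdorff_or_regular_imp_normal_space Hausdorff closed_map_quotient_proj c im]
      compact Hausdorff by blast
qed

end


section \<open>Equicontinuity of a quotient, expressed upstairs\<close>

definition orbit_close :: "('g, 'm) monoid_scheme \<Rightarrow> 'a topology \<Rightarrow> ('a \<Rightarrow> 'g \<Rightarrow> 'a) \<Rightarrow>
    ('a \<times> 'a) set \<Rightarrow> bool" where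
  "orbit_close G X f W \<longleftrightarrow> (\<forall>x\<in>topspace X. \<exists>U. openin X U \<and> x \<in> U \<and>
     (\<forall>y\<in>U. \<forall>t\<in>carrier G. (f x t, f y t) \<in> W))"

text \<open>Equicontinuity of the quotient flow without mentioning the quotient: the open neighbourhoods of \<open>S\<close>
  replace the entourages of \<open>X/S\<close>, see \<open>equicontinuous_quotient_iff\<close>.\<close>

definition equicontinuous_modulo :: "('g, 'm) monoid_scheme \<Rightarrow> 'a topology \<Rightarrow>
    ('a \<Rightarrow> 'g \<Rightarrow> 'a) \<Rightarrow> ('a \<times> 'a) set \<Rightarrow> bool" where
  "equicontinuous_modulo G X f S \<longleftrightarrow>
     (\<forall>W. openin (prod_topology X X) W \<and> S \<subseteq> W \<longrightarrow> orbit_close G X f W)"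

lemma orbit_close_mono: "orbit_close G X f V \<Longrightarrow> V \<subseteq> W \<Longrightarrow> orbit_close G X f W"
  unfolding orbit_close_def by (meson subsetD)

lemma orbit_close_INT:
  assumes "finite F" "\<And>i. i \<in> F \<Longrightarrow> orbit_close G X f (V i)"
  shows "orbit_close G X f (\<Inter>i\<in>F. V i)"
  using assms
proof (induction F rule: finite_induct)
  case empty
  then show ?case by (auto simp: orbit_close_def)
next
  case (insert i F)
  show ?case
    unfolding orbit_close_def
  proof
    fix x assume "x \<in> topspace X"
    then obtain U U' where "openin X U" "x \<in> U" "\<forall>y\<in>U. \<forall>t\<in>carrier G. (f x t, f y t) \<in> V i"
      and "openin X U'" "x \<in> U'" "\<forall>y\<in>U'. \<forall>t\<in>carrier G. (f x t, f y t) \<in> (\<Inter>i\<in>F. V i)"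
      using insert unfolding orbit_close_def by (metis insertCI)
    then show "\<exists>U. openin X U \<and> x \<in> U \<and>
        (\<forall>y\<in>U. \<forall>t\<in>carrier G. (f x t, f y t) \<in> (\<Inter>i\<in>insert i F. V i))"
      by (intro exI[of _ "U \<inter> U'"]) auto
  qed
qed

context flow
begin

text \<open>Preimages of entourages of \<open>X/S\<close> are neighbourhoods of \<open>S\<close>. Conversely every neighbourhood \<open>W\<close> of
  \<open>S\<close> contains such a preimage, because the squared projection is a closed map: remove from
  \<open>X/S \<times> X/S\<close> the image of the complement of \<open>W\<close>.\<close>

lemma equicontinuous_quotient_iff:
  assumes compact: "compact_space X" and Hausdorff: "Hausdorff_space X"
    and S: "closed_invariant_equiv G X f S"
  shows "equicontinuous_flow G (quotient_topology X S) (quotient_action S f) \<longleftrightarrow>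
    equicontinuous_modulo G X f S"
proof -
  let ?Y = "quotient_topology X S" and ?p = "quotient_proj S"
  let ?pp = "\<lambda>(x, y). (?p x, ?p y)"
  have equiv: "equiv (topspace X) S" and closed: "closedin (prod_topology X X) S"
    and inv: "\<And>x y t. (x, y) \<in> S \<Longrightarrow> t \<in> carrier G \<Longrightarrow> (f x t, f y t) \<in> S"
    using S by (auto simp: closed_invariant_equiv_def)
  note Y = compact_Hausdorff_quotient[OF compact Hausdorff equiv closed]
  note eq_iff = quotient_proj_eq_iff[OF compact Hausdorff equiv closed]
  have cont: "continuous_map X ?Y ?p" and surj: "?p ` topspace X = topspace ?Y"
    using quotient_map_quotient_proj[of X S]
    by (simp_all add: quotient_imp_continuous_map quotient_imp_surjective_map)
  have cont2: "continuous_map (prod_topology X X) (prod_topology ?Y ?Y) ?pp"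
    using cont by (simp add: continuous_map_prod_top)
  have cm: "closed_map (prod_topology X X) (prod_topology ?Y ?Y) ?pp"
    by (rule T1_Spaces.continuous_imp_closed_map[OF cont2
          compact_Hausdorff_square(1)[OF compact Hausdorff] compact_Hausdorff_square(2)[OF Y]])
  note act = quotient_action_quotient_proj[OF S]
  show ?thesis
  proof
    assume eq: "equicontinuous_flow G ?Y (quotient_action S f)"
    show "equicontinuous_modulo G X f S"
      unfolding equicontinuous_modulo_def orbit_close_def
    proof (intro allI impI ballI)
      fix W x
      assume W: "openin (prod_topology X X) W \<and> S \<subseteq> W" and x: "x \<in> topspace X"
      define D where "D = topspace ?Y \<times> topspace ?Y - ?pp ` (topspace X \<times> topspace X - W)"
      have "closedin (prod_topology X X) (topspace X \<times> topspace X - W)"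
        using W by (metis closedin_diff closedin_topspace topspace_prod_topology)
      then have "closedin (prod_topology ?Y ?Y) (?pp ` (topspace X \<times> topspace X - W))"
        using cm by (simp add: closed_map_def)
      then have "openin (prod_topology ?Y ?Y) D"
        unfolding D_def by (metis openin_diff openin_topspace topspace_prod_topology)
      moreover have "Id_on (topspace ?Y) \<subseteq> D"
      proof
        fix q assume "q \<in> Id_on (topspace ?Y)"
        then obtain z where z: "q = (z, z)" "z \<in> topspace ?Y" by blast
        have "q \<notin> ?pp ` (topspace X \<times> topspace X - W)"
        proof
          assume "q \<in> ?pp ` (topspace X \<times> topspace X - W)"
          then obtain u v where "u \<in> topspace X" "v \<in> topspace X" "(u, v) \<notin> W" "?p u = ?p v"
            using z(1) by auto
          then show False using eq_iff[of u v] W by blast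
        qed
        then show "q \<in> D" using z by (simp add: D_def)
      qed
      ultimately have "D \<in> uniformity_of ?Y"
        unfolding uniformity_of_eq_diagonal_nhds[OF Y]
        by (intro diagonal_nhdsI[of _ D]) (auto simp: D_def)
      moreover have "?p x \<in> topspace ?Y" using x surj by blast
      ultimately have "\<exists>N. openin ?Y N \<and> ?p x \<in> N \<and>
          (\<forall>y\<in>N. \<forall>t\<in>carrier G. (quotient_action S f (?p x) t, quotient_action S f y t) \<in> D)"
        using eq[unfolded equicontinuous_flow_def] by (elim ballE) blast+
      then obtain N where N: "openin ?Y N" "?p x \<in> N"
        "\<And>y t. y \<in> N \<Longrightarrow> t \<in> carrier G \<Longrightarrow>
          (quotient_action S f (?p x) t, quotient_action S f y t) \<in> D"
        by blast
      define U where "U = {y \<in> topspace X. ?p y \<in> N}"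
      have "openin X U" using N(1) by (simp add: U_def openin_quotient_topology)
      moreover have "x \<in> U" using x N by (simp add: U_def)
      moreover have "(f x t, f y t) \<in> W" if y: "y \<in> U" and t: "t \<in> carrier G" for y t
      proof -
        have yX: "y \<in> topspace X" using y by (simp add: U_def)
        have "(quotient_action S f (?p x) t, quotient_action S f (?p y) t) \<in> D"
          using N(3)[of "?p y" t] y t by (simp add: U_def)
        then have "(?p (f x t), ?p (f y t)) \<in> D" using act x yX t by simp
        moreover have "f x t \<in> topspace X" "f y t \<in> topspace X"
          using x yX t action_closed by auto
        ultimately show ?thesis
          using image_eqI[of "(?p (f x t), ?p (f y t))" ?pp "(f x t, f y t)"
              "topspace X \<times> topspace X - W"]
          unfolding D_def by auto
      qed
      ultimately show "\<exists>U. openin X U \<and> x \<in> U \<and> (\<forall>y\<in>U. \<forall>t\<in>carrier G. (f x t, f y t) \<in> W)"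
        by blast
    qed
  next
    assume E: "equicontinuous_modulo G X f S"
    show "equicontinuous_flow G ?Y (quotient_action S f)"
      unfolding equicontinuous_flow_def
    proof (intro ballI)
      fix z D assume z: "z \<in> topspace ?Y" and "D \<in> uniformity_of ?Y"
      then obtain D' where D': "openin (prod_topology ?Y ?Y) D'" "Id_on (topspace ?Y) \<subseteq> D'" "D' \<subseteq> D"
        unfolding uniformity_of_eq_diagonal_nhds[OF Y] by (elim diagonal_nhdsE)
      obtain x where x: "x \<in> topspace X" "z = ?p x" using z surj by blast
      define W where "W = {q \<in> topspace (prod_topology X X). ?pp q \<in> D'}"
      have "openin (prod_topology X X) W"
        unfolding W_def by (rule openin_continuous_map_preimage[OF cont2 D'(1)])
      moreover have "S \<subseteq> W"
      proof
        fix q assume q: "q \<in> S"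
        then obtain u v where uv: "q = (u, v)" "u \<in> topspace X" "v \<in> topspace X"
          using closedin_subset[OF closed] by force
        then have "?p u = ?p v" "?p u \<in> topspace ?Y" using q eq_iff surj by auto
        then have "?pp q \<in> D'" using uv(1) subsetD[OF D'(2), of "(?p u, ?p u)"] by auto
        then show "q \<in> W" using uv by (simp add: W_def)
      qed
      ultimately have "orbit_close G X f W"
        using E by (simp add: equicontinuous_modulo_def)
      then obtain U where U: "\<And>u. u \<in> topspace X \<Longrightarrow> openin X (U u) \<and> u \<in> U u \<and>
          (\<forall>y\<in>U u. \<forall>t\<in>carrier G. (f u t, f y t) \<in> W)"
        unfolding orbit_close_def by metis
      \<comment> \<open>A neighbourhood of \<open>x\<close> alone need not project to a neighbourhood of \<open>z\<close>; one needs a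
        neighbourhood of the whole class of \<open>x\<close>, whose points all have the same orbit in the quotient.\<close>
      define O' where "O' = (\<Union>u\<in>S `` {x}. U u)"
      have classX: "u \<in> topspace X" if "u \<in> S `` {x}" for u
        using that closedin_subset[OF closed] by auto
      have "openin X O'" unfolding O'_def using U classX by blast
      moreover have "{u \<in> topspace X. ?p u = z} \<subseteq> O'"
      proof
        fix u assume "u \<in> {u \<in> topspace X. ?p u = z}"
        then have "u \<in> S `` {x}" "u \<in> topspace X" using x eq_iff[of x u] by auto
        then show "u \<in> O'" using U unfolding O'_def by blast
      qed
      ultimately have "\<exists>N. openin ?Y N \<and> z \<in> N \<and> {u \<in> topspace X. ?p u \<in> N} \<subseteq> O'"
        using closed_map_quotient_proj[OF compact Hausdorff equiv closed,
            unfolded closed_map_fibre_neighbourhood] z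
        by blast
      then obtain N where N: "openin ?Y N" "z \<in> N" "{u \<in> topspace X. ?p u \<in> N} \<subseteq> O'"
        by blast
      have "(quotient_action S f z t, quotient_action S f y t) \<in> D"
        if y: "y \<in> N" and t: "t \<in> carrier G" for y t
      proof -
        have "y \<in> topspace ?Y" using y N openin_subset by blast
        then obtain v where v: "v \<in> topspace X" "y = ?p v" using surj by blast
        then have "v \<in> O'" using N y by blast
        then obtain u where u: "(x, u) \<in> S" "v \<in> U u" unfolding O'_def by blast
        have uX: "u \<in> topspace X" using u classX by blast
        have "(f u t, f v t) \<in> W" using U[OF uX] u t by blast
        then have "(?p (f u t), ?p (f v t)) \<in> D'" by (simp add: W_def)
        then have "(?p (f u t), ?p (f v t)) \<in> D" using D'(3) by blast
        moreover have "?p (f u t) = ?p (f x t)"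
          using inv[OF u(1) t] eq_iff[of "f x t" "f u t"] action_closed[OF x(1) t]
            action_closed[OF uX t] by simp
        ultimately show ?thesis using act[OF x(1) t] act[OF v(1) t] x(2) v(2) by simp
      qed
      then show "\<exists>U. openin ?Y U \<and> z \<in> U \<and>
          (\<forall>y\<in>U. \<forall>t\<in>carrier G. (quotient_action S f z t, quotient_action S f y t) \<in> D)"
        using N(1,2) by blast
    qed
  qed
qed


section \<open>Existence of the smallest equicontinuity relation\<close>

lemma closed_invariant_equiv_Inter:
  assumes "\<F> \<noteq> {}" "\<And>S. S \<in> \<F> \<Longrightarrow> closed_invariant_equiv G X f S"
  shows "closed_invariant_equiv G X f (\<Inter>\<F>)"
proof -
  have e: "equiv (topspace X) S" if "S \<in> \<F>" for S
    using assms(2)[OF that] by (simp add: closed_invariant_equiv_def)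
  have "equiv (topspace X) (\<Inter>\<F>)"
  proof (rule equivI)
    show "\<Inter>\<F> \<subseteq> topspace X \<times> topspace X" using e assms(1) equiv_type by blast
    show "refl_on (topspace X) (\<Inter>\<F>)"
      using e by (intro refl_onI InterI) (meson equivE refl_onD)
    show "sym (\<Inter>\<F>)"
      using e by (intro symI InterI) (meson InterD equivE symD)
    show "trans (\<Inter>\<F>)"
    proof (rule transI, rule InterI)
      fix x y z S assume "(x, y) \<in> \<Inter>\<F>" "(y, z) \<in> \<Inter>\<F>" and S: "S \<in> \<F>"
      then have "(x, y) \<in> S" "(y, z) \<in> S" by simp_all
      then show "(x, z) \<in> S" using e[OF S] by (meson equivE transD)
    qed
  qed
  moreover have "closedin (prod_topology X X) (\<Inter>\<F>)"
    using assms by (intro closedin_Inter) (auto simp: closed_invariant_equiv_def)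
  moreover have "\<forall>(x, y)\<in>\<Inter>\<F>. \<forall>t\<in>carrier G. (f x t, f y t) \<in> \<Inter>\<F>"
    using assms(2) unfolding closed_invariant_equiv_def by blast
  ultimately show ?thesis by (simp add: closed_invariant_equiv_def)
qed

text \<open>By compactness of the complement of \<open>W\<close>, a neighbourhood \<open>W\<close> of the intersection contains a finite
  intersection of neighbourhoods \<open>V\<close> of members of the family, and finitely many neighbourhoods \<open>U\<close> of a
  point can be intersected.\<close>

lemma equicontinuous_modulo_Inter:
  assumes X: "compact_space X" "Hausdorff_space X"
    and closed: "\<And>S. S \<in> \<F> \<Longrightarrow> closedin (prod_topology X X) S"
    and E: "\<And>S. S \<in> \<F> \<Longrightarrow> equicontinuous_modulo G X f S"
  shows "equicontinuous_modulo G X f (\<Inter>\<F>)"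
  unfolding equicontinuous_modulo_def
proof (intro allI impI)
  let ?Z = "prod_topology X X"
  note Z = compact_Hausdorff_square[OF X]
  fix W assume W: "openin ?Z W \<and> \<Inter>\<F> \<subseteq> W"
  let ?K = "topspace ?Z - W"
  have "\<exists>N V. openin ?Z N \<and> p \<in> N \<and> N \<inter> V = {} \<and> orbit_close G X f V" if p: "p \<in> ?K" for p
  proof -
    obtain S where S: "S \<in> \<F>" "p \<notin> S" using W p by blast
    then obtain N V where "openin ?Z N" "p \<in> N" "openin ?Z V" "S \<subseteq> V" "N \<inter> V = {}"
      using separate_point_from_closedin[OF Z closed] p by (metis DiffE)
    then show ?thesis using E[OF S(1)] unfolding equicontinuous_modulo_def by blast
  qed
  then obtain N V where NV: "\<And>p. p \<in> ?K \<Longrightarrow>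
      openin ?Z (N p) \<and> p \<in> N p \<and> N p \<inter> V p = {} \<and> orbit_close G X f (V p)"
    by metis
  have "compactin ?Z ?K"
    using W Z by (meson closedin_compact_space closedin_diff closedin_topspace)
  then obtain F where F: "finite F" "F \<subseteq> ?K" "?K \<subseteq> (\<Union>p\<in>F. N p)"
    using compactin_finite_pointwise_subcover[of ?Z ?K N] NV by metis
  have good: "orbit_close G X f (\<Inter>p\<in>F. V p)"
    using F NV by (intro orbit_close_INT) auto
  show "orbit_close G X f W"
    unfolding orbit_close_def
  proof
    fix x assume x: "x \<in> topspace X"
    obtain U where U: "openin X U" "x \<in> U" "\<forall>y\<in>U. \<forall>t\<in>carrier G. (f x t, f y t) \<in> (\<Inter>p\<in>F. V p)"
      using good x unfolding orbit_close_def by blast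
    have "(f x t, f y t) \<in> W" if y: "y \<in> U" and t: "t \<in> carrier G" for y t
    proof (rule ccontr)
      assume "(f x t, f y t) \<notin> W"
      moreover have "y \<in> topspace X" using y U openin_subset by blast
      ultimately have "(f x t, f y t) \<in> ?K" using x t action_closed by simp
      then obtain p where "p \<in> F" "(f x t, f y t) \<in> N p" using F by blast
      then show False using U y t F NV[of p] by blast
    qed
    then show "\<exists>U. openin X U \<and> x \<in> U \<and> (\<forall>y\<in>U. \<forall>t\<in>carrier G. (f x t, f y t) \<in> W)"
      using U by blast
  qed
qed

text \<open>These three properties show that the \<open>LEAST\<close> operator in the definition of \<open>S_eq\<close> denotes an actual
  least element, namely the intersection of all equicontinuity relations. The family is nonempty because
  the quotient by \<open>X \<times> X\<close> is trivial.\<close>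

lemma
  assumes X: "compact_space X" "Hausdorff_space X"
  shows closed_invariant_equiv_S_eq: "closed_invariant_equiv G X f (S_eq G X f)"
    and equicontinuous_modulo_S_eq: "equicontinuous_modulo G X f (S_eq G X f)"
    and S_eq_subset: "closed_invariant_equiv G X f S \<Longrightarrow> equicontinuous_modulo G X f S \<Longrightarrow>
      S_eq G X f \<subseteq> S"
proof -
  define \<F> where "\<F> = {S. closed_invariant_equiv G X f S \<and> equicontinuous_modulo G X f S}"
  have "equiv (topspace X) (topspace X \<times> topspace X)"
    by (intro equivI refl_onI symI transI) simp_all
  moreover have "closedin (prod_topology X X) (topspace X \<times> topspace X)"
    by (simp add: closedin_prod_Times_iff)
  ultimately have "closed_invariant_equiv G X f (topspace X \<times> topspace X)"
    using action_closed by (simp add: closed_invariant_equiv_def)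
  moreover have "orbit_close G X f (topspace X \<times> topspace X)"
    unfolding orbit_close_def using action_closed by (intro ballI exI[of _ "topspace X"]) simp
  then have "equicontinuous_modulo G X f (topspace X \<times> topspace X)"
    unfolding equicontinuous_modulo_def using orbit_close_mono by blast
  ultimately have ne: "\<F> \<noteq> {}" unfolding \<F>_def by blast
  have cie: "closed_invariant_equiv G X f (\<Inter>\<F>)"
    by (rule closed_invariant_equiv_Inter[OF ne]) (simp add: \<F>_def)
  have em: "equicontinuous_modulo G X f (\<Inter>\<F>)"
    by (rule equicontinuous_modulo_Inter[OF X]) (auto simp: \<F>_def closed_invariant_equiv_def)
  have "S_eq G X f = \<Inter>\<F>"
    unfolding S_eq_def
  proof (rule Least_equality)
    show "closed_invariant_equiv G X f (\<Inter>\<F>) \<and>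
        equicontinuous_flow G (quotient_topology X (\<Inter>\<F>)) (quotient_action (\<Inter>\<F>) f)"
      using cie em equicontinuous_quotient_iff[OF X cie] by simp
  next
    fix S assume "closed_invariant_equiv G X f S \<and>
        equicontinuous_flow G (quotient_topology X S) (quotient_action S f)"
    then have "S \<in> \<F>" using equicontinuous_quotient_iff[OF X] unfolding \<F>_def by blast
    then show "\<Inter>\<F> \<subseteq> S" by blast
  qed
  then show "closed_invariant_equiv G X f (S_eq G X f)" "equicontinuous_modulo G X f (S_eq G X f)"
    "closed_invariant_equiv G X f S \<Longrightarrow> equicontinuous_modulo G X f S \<Longrightarrow> S_eq G X f \<subseteq> S"
    using cie em by (auto simp: \<F>_def)
qed

end


section \<open>Splitting classes into their components\<close>

definition component_relation :: "'a topology \<Rightarrow> ('a \<times> 'a) set \<Rightarrow> ('a \<times> 'a) set" where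
  "component_relation X S =
     {(x, y). \<exists>K. connectedin X K \<and> x \<in> K \<and> y \<in> K \<and> K \<subseteq> S `` {x}}"

lemma component_relation_subset: "component_relation X S \<subseteq> S"
  by (auto simp: component_relation_def)

lemma equiv_component_relation:
  assumes S: "equiv (topspace X) S"
  shows "equiv (topspace X) (component_relation X S)"
proof (rule equivI)
  show "component_relation X S \<subseteq> topspace X \<times> topspace X"
    using component_relation_subset equiv_type[OF S] by blast
  show "refl_on (topspace X) (component_relation X S)"
  proof (rule refl_onI)
    fix x assume x: "x \<in> topspace X"
    then have "connectedin X {x}" "{x} \<subseteq> S `` {x}"
      using equiv_class_self[OF S x] by auto
    then show "(x, x) \<in> component_relation X S"
      unfolding component_relation_def by blast
  qed
  have cls: "S `` {x} = S `` {y}" if "(x, y) \<in> component_relation X S" for x y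
    using that component_relation_subset equiv_class_eq[OF S] by blast
  show "sym (component_relation X S)"
  proof (rule symI)
    fix x y assume xy: "(x, y) \<in> component_relation X S"
    then show "(y, x) \<in> component_relation X S"
      using cls[OF xy] unfolding component_relation_def by auto
  qed
  show "trans (component_relation X S)"
  proof (rule transI)
    fix x y z
    assume xy: "(x, y) \<in> component_relation X S" and yz: "(y, z) \<in> component_relation X S"
    then obtain K L where K: "connectedin X K" "x \<in> K" "y \<in> K" "K \<subseteq> S `` {x}"
      and L: "connectedin X L" "y \<in> L" "z \<in> L" "L \<subseteq> S `` {y}"
      unfolding component_relation_def by blast
    have "connectedin X (K \<union> L)" using K L by (intro connectedin_Un) auto
    moreover have "K \<union> L \<subseteq> S `` {x}" using K L cls[OF xy] by auto
    ultimately show "(x, z) \<in> component_relation X S"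
      using K L unfolding component_relation_def by blast
  qed
qed

text \<open>Upper semicontinuity of the classes of a closed relation, in a form that survives enlarging the relation
  to a neighbourhood: the points \<open>k\<close> with a related point outside \<open>Q\<close> form a closed set missing \<open>p\<close>, and
  \<open>V\<close> imposes the constraint \<open>y \<in> Q\<close> only outside a neighbourhood of that set.\<close>

lemma class_tube:
  assumes X: "compact_space X" "Hausdorff_space X" and closed: "closedin (prod_topology X X) S"
    and p: "p \<in> topspace X" and Q: "openin X Q" "S `` {p} \<subseteq> Q"
  obtains N V where "openin X N" "p \<in> N" "openin (prod_topology X X) V" "S \<subseteq> V"
    "\<And>k y. k \<in> N \<Longrightarrow> (k, y) \<in> V \<Longrightarrow> y \<in> Q"
proof -
  let ?A = "topspace X"
  have "closedin (prod_topology X X) (S \<inter> ?A \<times> (?A - Q))"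
    using closed Q by (intro closedin_Int) (auto simp: closedin_prod_Times_iff)
  then have C: "closedin X (fst ` (S \<inter> ?A \<times> (?A - Q)))"
    using Abstract_Topological_Spaces.closed_map_fst[OF X(1), of X] by (simp add: closed_map_def)
  have "p \<notin> fst ` (S \<inter> ?A \<times> (?A - Q))" using Q by auto
  then obtain N M where NM: "openin X N" "p \<in> N" "openin X M"
    "fst ` (S \<inter> ?A \<times> (?A - Q)) \<subseteq> M" "N \<inter> M = {}"
    using separate_point_from_closedin[OF X C p] by metis
  define V where "V = ?A \<times> Q \<union> M \<times> ?A"
  have "openin (prod_topology X X) V"
    unfolding V_def using Q NM by (intro openin_Un) (auto simp: openin_prod_Times_iff)
  moreover have "S \<subseteq> V"
    using closedin_subset[OF closed] NM(4) unfolding V_def by force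
  moreover have "y \<in> Q" if "k \<in> N" "(k, y) \<in> V" for k y
    using that NM unfolding V_def by blast
  ultimately show thesis using that NM by metis
qed

text \<open>The key step. If \<open>(p, q) \<in> S\<close>, then \<open>p\<close> and \<open>q\<close> lie in different components of their common class, so
  the class is covered by disjoint open sets \<open>U\<close> and \<open>U'\<close> containing \<open>p\<close> and \<open>q\<close>. For \<open>k\<close> near
  \<open>p\<close>, a set \<open>K\<close> with \<open>{k} \<times> K \<subseteq> V\<close> stays inside \<open>U \<union> U'\<close>, and it is disconnected if it meets both.
  If \<open>(p, q) \<notin> S\<close>, then \<open>(k, y)\<close> itself lies outside a neighbourhood \<open>V\<close> of \<open>S\<close>.
  The condition is \<open>{k} \<times> K \<subseteq> V\<close> rather than \<open>K \<times> K \<subseteq> V\<close> since equicontinuity at a point \<open>x\<close> compares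
  the orbit of \<open>x\<close> with nearby orbits, so that \<open>k\<close> will be a translate of \<open>x\<close>.\<close>

lemma component_relation_separation:
  assumes X: "compact_space X" "Hausdorff_space X"
    and equiv: "equiv (topspace X) S" and closed: "closedin (prod_topology X X) S"
    and pq: "p \<in> topspace X" "q \<in> topspace X" "(p, q) \<notin> component_relation X S"
  obtains N V where "openin (prod_topology X X) N" "(p, q) \<in> N"
    "openin (prod_topology X X) V" "S \<subseteq> V"
    "\<And>k y K. (k, y) \<in> N \<Longrightarrow> connectedin X K \<Longrightarrow> k \<in> K \<Longrightarrow> y \<in> K \<Longrightarrow> \<not> {k} \<times> K \<subseteq> V"
proof (cases "(p, q) \<in> S")
  case False
  have "(p, q) \<in> topspace (prod_topology X X)" using pq by simp
  then obtain N V where "openin (prod_topology X X) N" "(p, q) \<in> N"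
    "openin (prod_topology X X) V" "S \<subseteq> V" "N \<inter> V = {}"
    using separate_point_from_closedin[OF compact_Hausdorff_square[OF X] closed] False by metis
  then show thesis using that[of N V] by blast
next
  case True
  let ?C = "S `` {p}"
  have "closedin (prod_topology X X) (S \<inter> {p} \<times> topspace X)"
    using closed pq X(2)
    by (intro closedin_Int) (auto simp: closedin_prod_Times_iff closedin_Hausdorff_singleton)
  then have "closedin X (snd ` (S \<inter> {p} \<times> topspace X))"
    using Abstract_Topological_Spaces.closed_map_snd[OF X(1), of X] by (simp add: closed_map_def)
  moreover have "snd ` (S \<inter> {p} \<times> topspace X) = ?C"
    using closedin_subset[OF closed] by force
  ultimately have C: "closedin X ?C" by simp
  let ?SC = "subtopology X ?C"
  have compC: "compact_space ?SC"
    using C X(1) closedin_compact_space compact_space_subtopology by blast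
  have HC: "Hausdorff_space ?SC" using X(2) Hausdorff_space_subtopology by blast
  have pC: "p \<in> ?C" "q \<in> ?C" using True equiv_class_self[OF equiv pq(1)] by auto
  then have top: "p \<in> topspace ?SC" "q \<in> topspace ?SC" using pq by auto
  \<comment> \<open>In a compact Hausdorff space two points that no connected set joins are separated by a clopen
    partition.\<close>
  have "separated_between ?SC {p} {q}"
  proof (rule cut_wire_fence_theorem[OF compC HC])
    show "closedin ?SC {p}" "closedin ?SC {q}"
      using HC top closedin_Hausdorff_singleton by metis+
    show "disjnt K {p} \<or> disjnt K {q}" if "connectedin ?SC K" for K
      using that pq(3) unfolding component_relation_def connectedin_subtopology by auto
  qed
  then obtain A B where AB: "closedin ?SC A" "closedin ?SC B" "A \<union> B = topspace ?SC"
    "disjnt A B" "p \<in> A" "q \<in> B"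
    unfolding separated_between_alt by auto
  have "compactin X A" "compactin X B"
    using AB C X(1) by (meson closedin_trans_full closedin_compact_space)+
  then obtain U U' where U: "openin X U" "openin X U'" "A \<subseteq> U" "B \<subseteq> U'" "disjnt U U'"
    using Hausdorff_space_compact_separation[OF X(2)] AB(4) by metis
  have "?C \<subseteq> U \<union> U'"
    using AB U closedin_subset[OF C] by (auto simp: topspace_subtopology)
  then obtain N V where NV: "openin X N" "p \<in> N" "openin (prod_topology X X) V" "S \<subseteq> V"
    "\<And>k y. k \<in> N \<Longrightarrow> (k, y) \<in> V \<Longrightarrow> y \<in> U \<union> U'"
    using class_tube[OF X closed pq(1) openin_Un[OF U(1,2)]] by metis
  show thesis
  proof (rule that[of "(N \<inter> U) \<times> U'" V])
    show "openin (prod_topology X X) ((N \<inter> U) \<times> U')"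
      using NV U by (simp add: openin_prod_Times_iff openin_Int)
    show "(p, q) \<in> (N \<inter> U) \<times> U'" using NV AB U by auto
    fix k y K assume k: "(k, y) \<in> (N \<inter> U) \<times> U'" "connectedin X K" "k \<in> K" "y \<in> K"
    show "\<not> {k} \<times> K \<subseteq> V"
    proof
      assume "{k} \<times> K \<subseteq> V"
      then have "K \<subseteq> U \<union> U'" using NV(5) k by blast
      then show False
        using connectedinD[OF k(2) U(1,2)] k U(5) unfolding disjnt_def by blast
    qed
  qed (use NV in auto)
qed

text \<open>A connected set \<open>K\<close> witnessing \<open>(k, y) \<in> R\<close> satisfies \<open>{k} \<times> K \<subseteq> S\<close>, where \<open>R\<close> is the
  component relation; so the neighbourhoods \<open>N\<close> of the separation lemma avoid \<open>R\<close>.\<close>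

lemma closedin_component_relation:
  assumes X: "compact_space X" "Hausdorff_space X"
    and equiv: "equiv (topspace X) S" and closed: "closedin (prod_topology X X) S"
  shows "closedin (prod_topology X X) (component_relation X S)"
proof -
  let ?Z = "prod_topology X X" and ?R = "component_relation X S"
  have "\<exists>N. openin ?Z N \<and> r \<in> N \<and> N \<subseteq> topspace ?Z - ?R" if r: "r \<in> topspace ?Z - ?R" for r
  proof -
    obtain p q where pq: "r = (p, q)" "p \<in> topspace X" "q \<in> topspace X" "(p, q) \<notin> ?R"
      using r by auto
    obtain N V where N: "openin ?Z N" "(p, q) \<in> N" "S \<subseteq> V"
      "\<And>k y K. (k, y) \<in> N \<Longrightarrow> connectedin X K \<Longrightarrow> k \<in> K \<Longrightarrow> y \<in> K \<Longrightarrow> \<not> {k} \<times> K \<subseteq> V"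
      using component_relation_separation[OF X equiv closed pq(2-4)] by metis
    have "(k, y) \<notin> ?R" if "(k, y) \<in> N" for k y
    proof
      assume "(k, y) \<in> ?R"
      then obtain K where K: "connectedin X K" "k \<in> K" "y \<in> K" "K \<subseteq> S `` {k}"
        unfolding component_relation_def by blast
      then have "{k} \<times> K \<subseteq> V" using N(3) by blast
      then show False using N(4) that K by blast
    qed
    then have "N \<subseteq> topspace ?Z - ?R" using openin_subset[OF N(1)] by auto
    then show ?thesis using N pq by blast
  qed
  then have "openin ?Z (topspace ?Z - ?R)" by (subst openin_subopen) blast
  moreover have "?R \<subseteq> topspace ?Z"
    using component_relation_subset closedin_subset[OF closed] by blast
  ultimately show ?thesis by (simp add: closedin_def)
qed

context flow
begin

lemma continuous_map_time:
  assumes t: "t \<in> carrier G"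
  shows "continuous_map X X (\<lambda>x. f x t)"
proof -
  have "continuous_map X (prod_topology X \<tau>) (\<lambda>x. (x, t))"
    using t topspace_group by (simp add: continuous_map_pairedI)
  from continuous_map_compose[OF this continuous_map_action] show ?thesis
    by (simp add: o_def)
qed

lemma connectedin_time_image:
  "t \<in> carrier G \<Longrightarrow> connectedin X K \<Longrightarrow> connectedin X ((\<lambda>x. f x t) ` K)"
  by (rule connectedin_continuous_map_image[OF continuous_map_time])

lemma closed_invariant_equiv_component_relation:
  assumes X: "compact_space X" "Hausdorff_space X"
    and S: "closed_invariant_equiv G X f S"
  shows "closed_invariant_equiv G X f (component_relation X S)"
proof -
  have equiv: "equiv (topspace X) S" and closed: "closedin (prod_topology X X) S"
    and inv: "\<And>x y t. (x, y) \<in> S \<Longrightarrow> t \<in> carrier G \<Longrightarrow> (f x t, f y t) \<in> S"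
    using S by (auto simp: closed_invariant_equiv_def)
  have "(f x t, f y t) \<in> component_relation X S"
    if xy: "(x, y) \<in> component_relation X S" and t: "t \<in> carrier G" for x y t
  proof -
    obtain K where K: "connectedin X K" "x \<in> K" "y \<in> K" "K \<subseteq> S `` {x}"
      using xy unfolding component_relation_def by blast
    have "(\<lambda>x. f x t) ` K \<subseteq> S `` {f x t}"
    proof (rule image_subsetI)
      fix k assume "k \<in> K"
      then have "(x, k) \<in> S" using K(4) by blast
      then show "f k t \<in> S `` {f x t}" using inv t by blast
    qed
    moreover have "f x t \<in> (\<lambda>x. f x t) ` K" "f y t \<in> (\<lambda>x. f x t) ` K"
      using K by simp_all
    ultimately show ?thesis
      using connectedin_time_image[OF t K(1)]
      by (simp only: component_relation_def mem_Collect_eq prod.case)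
        (intro exI[of _ "(\<lambda>x. f x t) ` K"] conjI)
  qed
  then show ?thesis
    using equiv_component_relation[OF equiv] closedin_component_relation[OF X equiv closed]
    by (simp add: closed_invariant_equiv_def split_beta)
qed

text \<open>Finitely many of the separating neighbourhoods \<open>N\<close> cover the complement of \<open>W\<close>. A connected
  neighbourhood \<open>U\<close> of \<open>x\<close> on which orbits stay within all corresponding \<open>V\<close> has connected translates,
  and these cannot join a translate of \<open>x\<close> to a point that \<open>W\<close> does not relate to it.\<close>

lemma equicontinuous_modulo_component_relation:
  assumes X: "compact_space X" "Hausdorff_space X" and lc: "locally_connected_space X"
    and S: "closed_invariant_equiv G X f S" and E: "equicontinuous_modulo G X f S"
  shows "equicontinuous_modulo G X f (component_relation X S)"
  unfolding equicontinuous_modulo_def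
proof (intro allI impI)
  let ?Z = "prod_topology X X"
  have equiv: "equiv (topspace X) S" and closed: "closedin ?Z S"
    using S by (auto simp: closed_invariant_equiv_def)
  fix W assume W: "openin ?Z W \<and> component_relation X S \<subseteq> W"
  let ?K = "topspace ?Z - W"
  have "\<exists>N V. openin ?Z N \<and> r \<in> N \<and> orbit_close G X f V \<and>
      (\<forall>k y K. (k, y) \<in> N \<longrightarrow> connectedin X K \<longrightarrow> k \<in> K \<longrightarrow> y \<in> K \<longrightarrow> \<not> {k} \<times> K \<subseteq> V)"
    if r: "r \<in> ?K" for r
  proof -
    obtain p q where pq: "r = (p, q)" "p \<in> topspace X" "q \<in> topspace X"
      "(p, q) \<notin> component_relation X S"
      using r W by auto
    obtain N V where NV: "openin ?Z N" "(p, q) \<in> N" "openin ?Z V" "S \<subseteq> V"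
      "\<And>k y K. (k, y) \<in> N \<Longrightarrow> connectedin X K \<Longrightarrow> k \<in> K \<Longrightarrow> y \<in> K \<Longrightarrow> \<not> {k} \<times> K \<subseteq> V"
      using component_relation_separation[OF X equiv closed pq(2-4)] by metis
    have "orbit_close G X f V"
      using E NV(3,4) unfolding equicontinuous_modulo_def by blast
    then show ?thesis
      unfolding pq(1) using NV(1,2) by (intro exI[of _ N] exI[of _ V] conjI allI impI NV(5))
  qed
  then obtain N V where NV: "\<And>r. r \<in> ?K \<Longrightarrow> openin ?Z (N r) \<and> r \<in> N r \<and> orbit_close G X f (V r) \<and>
      (\<forall>k y K. (k, y) \<in> N r \<longrightarrow> connectedin X K \<longrightarrow> k \<in> K \<longrightarrow> y \<in> K \<longrightarrow> \<not> {k} \<times> K \<subseteq> V r)"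
    by metis
  have "compactin ?Z ?K"
    using W compact_Hausdorff_square[OF X]
    by (meson closedin_compact_space closedin_diff closedin_topspace)
  then obtain F where F: "finite F" "F \<subseteq> ?K" "?K \<subseteq> (\<Union>r\<in>F. N r)"
    using compactin_finite_pointwise_subcover[of ?Z ?K N] NV by metis
  have good: "orbit_close G X f (\<Inter>r\<in>F. V r)"
    using F NV by (intro orbit_close_INT) auto
  show "orbit_close G X f W"
    unfolding orbit_close_def
  proof
    fix x assume x: "x \<in> topspace X"
    obtain U' where U': "openin X U'" "x \<in> U'"
      "\<forall>y\<in>U'. \<forall>t\<in>carrier G. (f x t, f y t) \<in> (\<Inter>r\<in>F. V r)"
      using good x unfolding orbit_close_def by blast
    obtain U where U: "openin X U" "connectedin X U" "x \<in> U" "U \<subseteq> U'"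
      using lc U' unfolding locally_connected_space by metis
    have "(f x t, f y t) \<in> W" if y: "y \<in> U" and t: "t \<in> carrier G" for y t
    proof (rule ccontr)
      assume "(f x t, f y t) \<notin> W"
      moreover have "y \<in> topspace X" using y U openin_subset by blast
      ultimately have "(f x t, f y t) \<in> ?K" using x t action_closed by simp
      then obtain r where r: "r \<in> F" "(f x t, f y t) \<in> N r" using F by blast
      let ?Ut = "(\<lambda>x. f x t) ` U"
      have "connectedin X ?Ut" "f x t \<in> ?Ut" "f y t \<in> ?Ut"
        using connectedin_time_image[OF t U(2)] U y by auto
      moreover have "{f x t} \<times> ?Ut \<subseteq> V r" using U' U(4) t r by auto
      moreover have "r \<in> ?K" using r(1) F(2) by blast
      ultimately show False using NV[of r] r(2) by blast
    qed
    then show "\<exists>U. openin X U \<and> x \<in> U \<and> (\<forall>y\<in>U. \<forall>t\<in>carrier G. (f x t, f y t) \<in> W)"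
      using U by blast
  qed
qed

end


section \<open>Monotonicity of the maximal equicontinuous factor\<close>

lemma monotone_map_quotient_proj:
  assumes equiv: "equiv (topspace X) S" and sub: "S \<subseteq> component_relation X S"
  shows "monotone_map X (quotient_topology X S) (quotient_proj S)"
  unfolding monotone_map_def
proof (intro conjI ballI)
  show "quotient_proj S ` topspace X \<subseteq> topspace (quotient_topology X S)"
    by (simp add: quotient_imp_surjective_map[OF quotient_map_quotient_proj])
  fix C assume "C \<in> topspace (quotient_topology X S)"
  then obtain x where x: "x \<in> topspace X" "C = S `` {x}"
    unfolding topspace_quotient_topology by (auto elim: quotientE)
  have "{y \<in> topspace X. quotient_proj S y = C} = {y \<in> topspace X. (x, y) \<in> S}"
    using x eq_equiv_class_iff[OF equiv] by (auto simp: quotient_proj_def)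
  also have "\<dots> = S `` {x}"
    using equiv_type[OF equiv] by auto
  also have "\<dots> = \<Union>{K. connectedin X K \<and> x \<in> K \<and> K \<subseteq> S `` {x}}"
  proof (intro equalityI subsetI)
    fix y assume "y \<in> S `` {x}"
    then have "(x, y) \<in> component_relation X S" using sub by blast
    then show "y \<in> \<Union>{K. connectedin X K \<and> x \<in> K \<and> K \<subseteq> S `` {x}}"
      unfolding component_relation_def by blast
  qed blast
  finally have eq: "{y \<in> topspace X. quotient_proj S y = C} =
      \<Union>{K. connectedin X K \<and> x \<in> K \<and> K \<subseteq> S `` {x}}" .
  have "x \<in> \<Inter>{K. connectedin X K \<and> x \<in> K \<and> K \<subseteq> S `` {x}}" by blast
  then show "connectedin X {y \<in> topspace X. quotient_proj S y = C}"
    unfolding eq by (intro connectedin_Union) auto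
qed

theorem theoremA:
  fixes G :: "('g, 'm) monoid_scheme" and \<tau> :: "'g topology"
    and X :: "'a topology" and f :: "'a \<Rightarrow> 'g \<Rightarrow> 'a"
  assumes "flow G \<tau> X f"
    and "compact_space X" and "Hausdorff_space X" and "locally_connected_space X"
  shows "monotone_map X (quotient_topology X (S_eq G X f)) (quotient_proj (S_eq G X f))"
proof -
  interpret flow G \<tau> X f by fact
  note X = assms(2,3)
  note S = closed_invariant_equiv_S_eq[OF X] and E = equicontinuous_modulo_S_eq[OF X]
  have "S_eq G X f \<subseteq> component_relation X (S_eq G X f)"
    using closed_invariant_equiv_component_relation[OF X S]
      equicontinuous_modulo_component_relation[OF X assms(4) S E]
    by (rule S_eq_subset[OF X])
  moreover have "equiv (topspace X) (S_eq G X f)"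
    using S by (simp add: closed_invariant_equiv_def)
  ultimately show ?thesis by (intro monotone_map_quotient_proj)
qed

end
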